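(* Suppose $G$ is a group acting faithfully on a chain connected uniform space $X$. The action is small scale uniformly continuous and the projection $p\colon X\to X/G$ is a uniform covering map if and only if the action is neutral and uniformly properly discontinuous.
   Context: All entourages are symmetric subsets containing the diagonal. The action is a left action by bijections; the maps $x\mapsto g\cdot x$ are not assumed uniformly continuous. $X/G$ is the orbit set and $p$ the quotient map. The action is faithful if $g\cdot x=x$ for all $x\in X$ implies $g=1$. For $f\colon X\to Y$ and $E\subset X\times X$, $f(E)=\{(f(x),f(y)) : (x,y)\in E\}$. An $E$-chain is a finite sequence $x_1,\dots,x_n$ with $(x_i,x_{i+1})\in E$ for all $i<n$. $X$ is chain connected if for every entourage $E$ any two points are joined by an $E$-chain. A map $f\colon X\to Y$ generates the uniform structure on $Y$ if the sets $f(E)$, $E$ an entourage of $X$, are entourages of $Y$ and form a base of its uniform structure. A surjective $f$ has the chain lifting property if for any entourage $E$ of $X$ there is an entourage $F$ of $X$ such that for every $x_0\in X$ any $f(F)$-chain in $Y$ starting from $f(x_0)$ lifts to an $E$-chain starting from $x_0$. It has the uniqueness of chain lifts property if for every entourage $E$ of $X$ there is an entourage $F$ of $X$ such that any two $F$-chains $\alpha,\beta$ with $f(\alpha)=f(\beta)$ and the same initial point are equal. A uniform covering map is a map that generates the uniform structure on its target and has both properties. $X/G$ is given the uniform structure generated by $p$, so that "$p$ is a uniform covering map" includes that the sets $p(E)$ form a base of a uniform structure (automatic when $p$ has the chain lifting property). For an entourage $F$ of $X$, $S_F=\{h\in G : (x,h\cdot x)\in F\text{ for some }x\in X\}$ and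 $G_F$ is the subgroup generated by $S_F$. For $g\in G$, $g^{-1}(E)=\{(x,y) : (g\cdot x,g\cdot y)\in E\}$. The action is: - small scale uniformly continuous if for each entourage $E$ there is an entourage $F$ such that for each $g\in G_F$, $g^{-1}(E)$ is an entourage of $X$; - neutral if for each entourage $E$ there is an entourage $F$ such that $(x,h\cdot y)\in F$ (with $x,y\in X$, $h\in G$) implies the existence of $g\in G$ with $(g\cdot x,y)\in E$; - uniformly properly discontinuous if there is an entourage $E$ such that for all $x\in X$ and $g\in G$, $(x,g\cdot x)\in E$ implies $g=1$. *)

theory Defs
  imports Complex_Main "HOL-Algebra.Group_Action" "HOL-Algebra.Generated_Groups"
begin

section \<open>Uniform structures on carrier sets\<close>

text \<open>
  The type class \<open>uniform_space\<close> cannot carry the uniform structure of an orbit set, which is a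
  set of sets depending on the action, so uniform structures are given on carrier sets.  By
  convention an entourage is symmetric; the family \<open>U\<close> therefore consists of the symmetric
  entourages only and is closed under symmetric supersets.  No separation axiom is assumed and
  the carrier may be empty.
\<close>

locale uniform_structure =
  fixes X :: "'a set" and U :: "('a \<times> 'a) set set"
  assumes entourage_ex: "U \<noteq> {}"
    and entourage_subset: "E \<in> U \<Longrightarrow> E \<subseteq> X \<times> X"
    and entourage_diag: "E \<in> U \<Longrightarrow> Id_on X \<subseteq> E"
    and entourage_sym: "E \<in> U \<Longrightarrow> sym E"
    and entourage_Int: "E \<in> U \<Longrightarrow> F \<in> U \<Longrightarrow> E \<inter> F \<in> U"
    and entourage_superset: "E \<in> U \<Longrightarrow> E \<subseteq> F \<Longrightarrow> F \<subseteq> X \<times> X \<Longrightarrow> sym F \<Longrightarrow> F \<in> U"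
    and entourage_half: "E \<in> U \<Longrightarrow> \<exists>F\<in>U. F O F \<subseteq> E"

text \<open>
  The symmetric entourages of a type of class \<open>uniform_space\<close> form such a structure.
\<close>

lemma uniform_structure_UNIV:
  "uniform_structure UNIV
     {E :: ('a::uniform_space \<times> 'a) set. sym E \<and> eventually (\<lambda>p. p \<in> E) uniformity}"
proof
  show "{E :: ('a \<times> 'a) set. sym E \<and> eventually (\<lambda>p. p \<in> E) uniformity} \<noteq> {}"
    by (auto intro!: exI[of _ UNIV] simp: sym_def)
next
  fix E :: "('a \<times> 'a) set"
  assume E: "E \<in> {E. sym E \<and> eventually (\<lambda>p. p \<in> E) uniformity}"
  show "Id_on UNIV \<subseteq> E"
    using E uniformity_refl[of "\<lambda>p. p \<in> E"] by auto
  from E obtain D where D: "eventually D uniformity"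
    and DE: "\<And>x y z. D (x, y) \<Longrightarrow> D (y, z) \<Longrightarrow> (x, z) \<in> E"
    using uniformity_trans[of "\<lambda>p. p \<in> E"] by auto
  let ?F = "{(x, y). D (x, y) \<and> D (y, x)}"
  have "eventually (\<lambda>p. p \<in> ?F) uniformity"
    using eventually_conj[OF D uniformity_sym[OF D]] by (simp add: case_prod_beta)
  moreover have "sym ?F" by (auto simp: sym_def)
  moreover have "?F O ?F \<subseteq> E" using DE by auto
  ultimately show "\<exists>F\<in>{E. sym E \<and> eventually (\<lambda>p. p \<in> E) uniformity}. F O F \<subseteq> E"
    by blast
qed (auto simp: sym_Int dest: eventually_conj elim: eventually_mono)

definition chain_in :: "'a set \<Rightarrow> ('a \<times> 'a) set \<Rightarrow> 'a list \<Rightarrow> bool" where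
  "chain_in X E xs \<longleftrightarrow> xs \<noteq> [] \<and> set xs \<subseteq> X \<and> successively (\<lambda>x y. (x, y) \<in> E) xs"

definition chain_connected :: "'a set \<Rightarrow> ('a \<times> 'a) set set \<Rightarrow> bool" where
  "chain_connected X U \<longleftrightarrow>
     (\<forall>E\<in>U. \<forall>x\<in>X. \<forall>y\<in>X. \<exists>xs. chain_in X E xs \<and> hd xs = x \<and> last xs = y)"


section \<open>Uniform covering maps\<close>

definition generates_structure ::
  "('a \<times> 'a) set set \<Rightarrow> ('b \<times> 'b) set set \<Rightarrow> ('a \<Rightarrow> 'b) \<Rightarrow> bool" where
  "generates_structure U V f \<longleftrightarrow>
     (\<forall>E\<in>U. map_prod f f ` E \<in> V) \<and> (\<forall>D\<in>V. \<exists>E\<in>U. map_prod f f ` E \<subseteq> D)"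

definition chain_lifting ::
  "'a set \<Rightarrow> ('a \<times> 'a) set set \<Rightarrow> 'b set \<Rightarrow> ('a \<Rightarrow> 'b) \<Rightarrow> bool" where
  "chain_lifting X U Y f \<longleftrightarrow> f ` X = Y \<and>
     (\<forall>E\<in>U. \<exists>F\<in>U. \<forall>x\<^sub>0\<in>X. \<forall>ys.
        chain_in Y (map_prod f f ` F) ys \<and> hd ys = f x\<^sub>0 \<longrightarrow>
        (\<exists>xs. chain_in X E xs \<and> hd xs = x\<^sub>0 \<and> map f xs = ys))"

text \<open>
  In the next definition \<open>E\<close> does not occur in the condition on \<open>F\<close>; one may always shrink \<open>F\<close>
  to a subset of \<open>E\<close>, as the condition is inherited by smaller entourages.
\<close>

definition unique_chain_lifts ::
  "'a set \<Rightarrow> ('a \<times> 'a) set set \<Rightarrow> ('a \<Rightarrow> 'b) \<Rightarrow> bool" where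
  "unique_chain_lifts X U f \<longleftrightarrow>
     (\<forall>E\<in>U. \<exists>F\<in>U. \<forall>\<alpha> \<beta>.
        chain_in X F \<alpha> \<and> chain_in X F \<beta> \<and> map f \<alpha> = map f \<beta> \<and> hd \<alpha> = hd \<beta> \<longrightarrow> \<alpha> = \<beta>)"

definition uniform_covering_map ::
  "'a set \<Rightarrow> ('a \<times> 'a) set set \<Rightarrow> 'b set \<Rightarrow> ('b \<times> 'b) set set \<Rightarrow> ('a \<Rightarrow> 'b) \<Rightarrow> bool" where
  "uniform_covering_map X U Y V f \<longleftrightarrow>
     uniform_structure X U \<and> uniform_structure Y V \<and> f \<in> X \<rightarrow> Y \<and>
     generates_structure U V f \<and> chain_lifting X U Y f \<and> unique_chain_lifts X U f"

text \<open>
  The family with base \<open>f(E)\<close>, \<open>E \<in> U\<close>.  It need not be a uniform structure in general; that it is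
  one is part of \<^const>\<open>uniform_covering_map\<close>.
\<close>

definition generated_structure ::
  "('a \<times> 'a) set set \<Rightarrow> 'b set \<Rightarrow> ('a \<Rightarrow> 'b) \<Rightarrow> ('b \<times> 'b) set set" where
  "generated_structure U Y f =
     {D. D \<subseteq> Y \<times> Y \<and> sym D \<and> (\<exists>E\<in>U. map_prod f f ` E \<subseteq> D)}"

lemma generates_structure_unique:
  assumes "uniform_structure Y V" "generates_structure U V f"
  shows "V = generated_structure U Y f"
proof -
  interpret uniform_structure Y V by fact
  show ?thesis
  proof (intro equalityI subsetI)
    fix D assume "D \<in> V"
    then show "D \<in> generated_structure U Y f"
      using assms(2) entourage_subset[of D] entourage_sym[of D]
      by (simp add: generates_structure_def generated_structure_def)
  next
    fix D assume "D \<in> generated_structure U Y f"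
    then obtain E where "E \<in> U" "map_prod f f ` E \<subseteq> D" "D \<subseteq> Y \<times> Y" "sym D"
      unfolding generated_structure_def by blast
    then show "D \<in> V"
      using assms(2) entourage_superset[of "map_prod f f ` E" D]
      by (simp add: generates_structure_def)
  qed
qed


section \<open>Group actions on uniform spaces\<close>

text \<open>
  An action of \<open>G\<close> on \<open>X\<close> is a homomorphism \<open>\<phi>\<close> from \<open>G\<close> to the group of bijections of the set \<open>X\<close>,
  with \<open>g \<cdot> x\<close> being \<open>\<phi> g x\<close>.  Faithfulness in \<^locale>\<open>faithful_action\<close> is injectivity of \<open>\<phi>\<close>,
  which is the following condition on points.
\<close>

lemma faithful_action_iff:
  "faithful_action G X \<phi> \<longleftrightarrow>
     group_action G X \<phi> \<and> (\<forall>g\<in>carrier G. (\<forall>x\<in>X. \<phi> g x = x) \<longrightarrow> g = \<one>\<^bsub>G\<^esub>)"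
proof (cases "group_action G X \<phi>")
  case True
  then interpret group_action G X \<phi> .
  interpret hom: group_hom G "BijGroup X" \<phi> by (rule group_hom)
  have "(\<forall>x\<in>X. \<phi> g x = x) \<longleftrightarrow> \<phi> g = \<one>\<^bsub>BijGroup X\<^esub>" if "g \<in> carrier G" for g
    using bij_prop0[OF that]
    by (auto simp: BijGroup_def Bij_def extensional_def fun_eq_iff restrict_def)
  then show ?thesis
    using True hom.inj_on_one_iff
    by (auto simp: faithful_action_def faithful_action_axioms_def)
qed (simp add: faithful_action_def)

definition small_displacement ::
  "('g, 'm) monoid_scheme \<Rightarrow> 'a set \<Rightarrow> ('g \<Rightarrow> 'a \<Rightarrow> 'a) \<Rightarrow> ('a \<times> 'a) set \<Rightarrow> 'g set" where
  "small_displacement G X \<phi> F = {h \<in> carrier G. \<exists>x\<in>X. (x, \<phi> h x) \<in> F}"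

definition preimage_rel :: "'a set \<Rightarrow> ('a \<Rightarrow> 'b) \<Rightarrow> ('b \<times> 'b) set \<Rightarrow> ('a \<times> 'a) set" where
  "preimage_rel X f E = {(x, y) \<in> X \<times> X. (f x, f y) \<in> E}"

definition small_scale_uniformly_continuous ::
  "('g, 'm) monoid_scheme \<Rightarrow> 'a set \<Rightarrow> ('a \<times> 'a) set set \<Rightarrow> ('g \<Rightarrow> 'a \<Rightarrow> 'a) \<Rightarrow> bool" where
  "small_scale_uniformly_continuous G X U \<phi> \<longleftrightarrow>
     (\<forall>E\<in>U. \<exists>F\<in>U. \<forall>g\<in>generate G (small_displacement G X \<phi> F). preimage_rel X (\<phi> g) E \<in> U)"

definition neutral_action ::
  "('g, 'm) monoid_scheme \<Rightarrow> 'a set \<Rightarrow> ('a \<times> 'a) set set \<Rightarrow> ('g \<Rightarrow> 'a \<Rightarrow> 'a) \<Rightarrow> bool" where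
  "neutral_action G X U \<phi> \<longleftrightarrow>
     (\<forall>E\<in>U. \<exists>F\<in>U. \<forall>x\<in>X. \<forall>y\<in>X. \<forall>h\<in>carrier G.
        (x, \<phi> h y) \<in> F \<longrightarrow> (\<exists>g\<in>carrier G. (\<phi> g x, y) \<in> E))"

definition uniformly_properly_discontinuous ::
  "('g, 'm) monoid_scheme \<Rightarrow> 'a set \<Rightarrow> ('a \<times> 'a) set set \<Rightarrow> ('g \<Rightarrow> 'a \<Rightarrow> 'a) \<Rightarrow> bool" where
  "uniformly_properly_discontinuous G X U \<phi> \<longleftrightarrow>
     (\<exists>E\<in>U. \<forall>x\<in>X. \<forall>g\<in>carrier G. (x, \<phi> g x) \<in> E \<longrightarrow> g = \<one>\<^bsub>G\<^esub>)"

end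

theory Submission
  imports Defs
begin

text \<open>
  Lifting chains reduces to lifting single edges.  An edge of \<open>X/G\<close> in \<open>p(F)\<close> starting at
  \<open>p(x)\<close> comes from a pair of \<open>F\<close> that need not start at \<open>x\<close> but only at a point \<open>h \<cdot> x\<close>;
  neutrality says precisely that the far end of such a pair can be moved by the group to a point
  near \<open>x\<close>.  So neutrality is the chain lifting property of \<open>p\<close> (\<open>neutral_iff_chain_lifting\<close>).
  Chain lifting in turn makes the sets \<open>p(E)\<close> a base of a uniform structure, since a path of two
  edges lifts to a path of two edges (\<open>chain_lifting_imp_generated_structure\<close>).

  Under uniform proper discontinuity two points of one orbit that are close are equal.  Two lifts
  of an edge from a common starting point have close end points in one orbit, hence lifts are
  unique (\<open>locally_injective_imp_unique_chain_lifts\<close>).  Moreover \<open>G\<^sub>F\<close> is trivial for small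
  \<open>F\<close>, so small scale uniform continuity holds trivially.

  Conversely, let \<open>(x, g \<cdot> x)\<close> lie in a small entourage.  Small scale uniform continuity lets a
  fine chain \<open>\<alpha>\<close> from \<open>x\<close> to an arbitrary \<open>y\<close> be chosen so that \<open>g \<cdot> \<alpha>\<close> is fine as well.
  Both \<open>\<alpha>\<close> and \<open>g \<cdot> \<alpha>\<close> can be extended by the initial point \<open>x\<close>, and then they are two lifts of
  the same chain from the same point.  Uniqueness of lifts yields \<open>g \<cdot> y = y\<close> for all \<open>y\<close>, and
  \<open>g = 1\<close> by faithfulness (\<open>unique_lifts_imp_uniformly_properly_discontinuous\<close>).
\<close>

section \<open>Chain lifting in terms of single edges\<close>

context uniform_structure
begin

lemma entourage_in_carrier:
  assumes "E \<in> U" "(x, y) \<in> E"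
  shows "x \<in> X" "y \<in> X"
  using entourage_subset[OF assms(1)] assms(2) by auto

lemma entourage_refl: "E \<in> U \<Longrightarrow> x \<in> X \<Longrightarrow> (x, x) \<in> E"
  using entourage_diag by blast

text \<open>
  Lifted edges can be concatenated, because an edge can be lifted from any point over its
  starting point; this is the reason why single edges suffice.
\<close>

lemma chain_lifting_iff_edge_lifting:
  "chain_lifting X U Y f \<longleftrightarrow> f ` X = Y \<and>
     (\<forall>E\<in>U. \<exists>F\<in>U. \<forall>x\<in>X. \<forall>y.
        (f x, y) \<in> map_prod f f ` F \<longrightarrow> (\<exists>z. (x, z) \<in> E \<and> f z = y))"
    (is "_ \<longleftrightarrow> _ \<and> (\<forall>E\<in>U. \<exists>F\<in>U. ?edges E F)")
proof -
  have "(\<forall>x\<in>X. \<forall>ys. chain_in Y (map_prod f f ` F) ys \<and> hd ys = f x \<longrightarrow>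
           (\<exists>xs. chain_in X E xs \<and> hd xs = x \<and> map f xs = ys)) \<longleftrightarrow> ?edges E F"
    (is "?chains \<longleftrightarrow> _")
    if Y: "f ` X = Y" and E: "E \<in> U" and F: "F \<in> U" for E F
  proof
    assume chains: ?chains
    show "?edges E F"
    proof (intro ballI allI impI)
      fix x y assume x: "x \<in> X" and xy: "(f x, y) \<in> map_prod f f ` F"
      have "y \<in> Y" using xy Y entourage_in_carrier[OF F] by auto
      then have "chain_in Y (map_prod f f ` F) [f x, y]"
        using x xy Y by (auto simp: chain_in_def)
      then obtain xs where "chain_in X E xs" "hd xs = x" "map f xs = [f x, y]"
        using chains x list.sel(1)[of "f x" "[y]"] by metis
      then show "\<exists>z. (x, z) \<in> E \<and> f z = y"
        by (auto simp: chain_in_def)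
    qed
  next
    assume edges: "?edges E F"
    have "\<exists>xs. chain_in X E xs \<and> hd xs = x \<and> map f xs = ys"
      if "chain_in Y (map_prod f f ` F) ys" "hd ys = f x" "x \<in> X" for ys x
      using that
    proof (induction ys arbitrary: x)
      case Nil
      then show ?case by (simp add: chain_in_def)
    next
      case (Cons y ys)
      show ?case
      proof (cases ys)
        case Nil
        then show ?thesis
          using Cons.prems by (intro exI[of _ "[x]"]) (simp add: chain_in_def)
      next
        case (Cons y' ys')
        then have "(f x, y') \<in> map_prod f f ` F"
          using Cons.prems by (simp add: chain_in_def)
        then obtain z where z: "(x, z) \<in> E" "f z = y'"
          using edges Cons.prems(3) by metis
        moreover have "chain_in Y (map_prod f f ` F) ys"
          using Cons.prems(1) Cons by (simp add: chain_in_def)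
        moreover have "hd ys = f z" using z Cons by simp
        moreover have "z \<in> X" using E z entourage_in_carrier by blast
        ultimately obtain zs where zs: "chain_in X E zs" "hd zs = z" "map f zs = ys"
          using Cons.IH by blast
        have "chain_in X E (x # zs)"
          using zs z Cons.prems(3) by (auto simp: chain_in_def successively_Cons)
        then show ?thesis
          using zs Cons.prems(2) by (intro exI[of _ "x # zs"]) simp
      qed
    qed
    then show ?chains by blast
  qed
  then show ?thesis
    unfolding chain_lifting_def
    by (intro conj_cong[OF refl ball_cong[OF refl bex_cong[OF refl]]])
qed

text \<open>
  The only axiom that a surjection could violate is the existence of halves: two composable edges of
  \<open>f(F)\<close> come from pairs in \<open>X\<close> that need not be composable.  Lifting the edges one after the
  other makes them so.
\<close>

lemma chain_lifting_imp_generated_structure: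
  assumes "chain_lifting X U Y f"
  shows "uniform_structure Y (generated_structure U Y f)"
    and "generates_structure U (generated_structure U Y f) f"
proof -
  have Y: "f ` X = Y"
    using assms by (simp add: chain_lifting_def)
  have image: "map_prod f f ` E \<in> generated_structure U Y f" if "E \<in> U" for E
  proof -
    have "map_prod f f ` E \<subseteq> Y \<times> Y"
      using Y entourage_in_carrier[OF that] by auto
    moreover have "sym (map_prod f f ` E)"
      using entourage_sym[OF that] by (force simp: sym_def)
    ultimately show ?thesis
      using that by (auto simp: generated_structure_def)
  qed
  then show "generates_structure U (generated_structure U Y f) f"
    by (auto simp: generates_structure_def generated_structure_def)
  show "uniform_structure Y (generated_structure U Y f)"
  proof
    show "generated_structure U Y f \<noteq> {}"
      using entourage_ex image by blast
  next
    fix D assume "D \<in> generated_structure U Y f"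
    then obtain E where E: "E \<in> U" "map_prod f f ` E \<subseteq> D"
      by (auto simp: generated_structure_def)
    show "Id_on Y \<subseteq> D"
      using E entourage_refl Y by fastforce
    obtain E' where E': "E' \<in> U" "E' O E' \<subseteq> E"
      using entourage_half E by blast
    obtain F where F: "F \<in> U" and
      lift: "\<And>x y. x \<in> X \<Longrightarrow> (f x, y) \<in> map_prod f f ` F \<Longrightarrow> \<exists>z. (x, z) \<in> E' \<and> f z = y"
      using assms E'(1) unfolding chain_lifting_iff_edge_lifting by meson
    have "map_prod f f ` F O map_prod f f ` F \<subseteq> D"
    proof (rule subrelI)
      fix p q assume "(p, q) \<in> map_prod f f ` F O map_prod f f ` F"
      then obtain a b c d where pq: "p = f a" "q = f d"
        and ab: "(a, b) \<in> F" and cd: "(c, d) \<in> F" and bc: "f c = f b"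
        by auto
      obtain z where z: "(a, z) \<in> E'" "f z = f b"
        using lift[OF entourage_in_carrier(1)[OF F ab] map_prod_imageI[OF ab]] by blast
      have "(f z, f d) \<in> map_prod f f ` F"
        using map_prod_imageI[OF cd, of f f] z(2) bc by simp
      then obtain w where w: "(z, w) \<in> E'" "f w = f d"
        using lift[OF entourage_in_carrier(2)[OF E'(1) z(1)]] by metis
      have "(a, w) \<in> E" using z w E'(2) by blast
      then show "(p, q) \<in> D" using pq w(2) E(2) by force
    qed
    then show "\<exists>F\<in>generated_structure U Y f. F O F \<subseteq> D"
      using image[OF F] by blast
  next
    fix D D' assume "D \<in> generated_structure U Y f" "D' \<in> generated_structure U Y f"
    then obtain E E' where "E \<in> U" "map_prod f f ` E \<subseteq> D" "E' \<in> U" "map_prod f f ` E' \<subseteq> D'"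
      and "D \<inter> D' \<subseteq> Y \<times> Y" "sym (D \<inter> D')"
      by (auto simp: generated_structure_def sym_Int)
    moreover from this have "E \<inter> E' \<in> U" "map_prod f f ` (E \<inter> E') \<subseteq> D \<inter> D'"
      using entourage_Int by blast+
    ultimately show "D \<inter> D' \<in> generated_structure U Y f"
      by (auto simp: generated_structure_def)
  qed (auto simp: generated_structure_def, meson subset_trans)
qed

text \<open>
  Two lifts \<open>(x, a)\<close> and \<open>(x, b)\<close> of an edge in a half of \<open>E\<close> give the pair \<open>(a, b)\<close> in \<open>E\<close>
  with \<open>f(a) = f(b)\<close>.
\<close>

lemma locally_injective_imp_unique_chain_lifts:
  assumes E: "E \<in> U" and inj: "\<And>a b. (a, b) \<in> E \<Longrightarrow> f a = f b \<Longrightarrow> a = b"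
  shows "unique_chain_lifts X U f"
proof -
  obtain F where F: "F \<in> U" "F O F \<subseteq> E"
    using entourage_half E by blast
  have "\<alpha> = \<beta>" if "successively (\<lambda>x y. (x, y) \<in> F) \<alpha>" "successively (\<lambda>x y. (x, y) \<in> F) \<beta>"
    "map f \<alpha> = map f \<beta>" "hd \<alpha> = hd \<beta>" for \<alpha> \<beta>
    using that
  proof (induction \<alpha> arbitrary: \<beta>)
    case Nil
    then show ?case by simp
  next
    case (Cons x \<alpha>)
    then obtain \<beta>' where \<beta>: "\<beta> = x # \<beta>'" "map f \<alpha> = map f \<beta>'"
      by (cases \<beta>) auto
    have "\<alpha> = \<beta>'"
    proof (cases \<alpha>)
      case Nil
      then show ?thesis using \<beta> by simp
    next
      case (Cons a \<alpha>')
      then obtain b \<beta>'' where b: "\<beta>' = b # \<beta>''" "f a = f b"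
        using \<beta> by (cases \<beta>') auto
      have "(x, a) \<in> F" "(x, b) \<in> F"
        using Cons.prems Cons \<beta> b by simp_all
      then have "(a, b) \<in> E"
        using F entourage_sym by (blast dest: symD)
      then show ?thesis
        using inj Cons.IH[of \<beta>'] Cons.prems Cons \<beta> b by simp
    qed
    then show ?case using \<beta> by simp
  qed
  then show ?thesis
    using F(1) unfolding unique_chain_lifts_def chain_in_def by blast
qed

end

section \<open>The orbit map of an action on a uniform space\<close>

lemma (in group_action) orbit_eq_iff:
  assumes "x \<in> E" "y \<in> E"
  shows "orbit G \<phi> x = orbit G \<phi> y \<longleftrightarrow> (\<exists>g\<in>carrier G. y = \<phi> g x)"
proof -
  have "(\<exists>g\<in>carrier G. y = \<phi> g x) \<longleftrightarrow> y \<in> orbit G \<phi> x"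
    by (auto simp: orbit_def)
  also have "\<dots> \<longleftrightarrow> orbit G \<phi> x = orbit G \<phi> y"
    using assms disjoint_union[of "orbit G \<phi> x" "orbit G \<phi> y"] orbit_refl
    by (auto simp: orbits_def)
  finally show ?thesis by simp
qed

locale uniform_action = uniform_structure X U + group_action G X \<phi>
  for X :: "'a set" and U :: "('a \<times> 'a) set set"
    and G :: "('g, 'm) monoid_scheme" and \<phi> :: "'g \<Rightarrow> 'a \<Rightarrow> 'a"
begin

text \<open>
  The defining condition of neutrality is edge lifting for the pair of orbits of \<open>y\<close> and \<open>x\<close>,
  with \<open>y\<close> as the prescribed starting point and \<open>g \<cdot> x\<close> as the end point of the lift.  The
  reversal of direction is harmless, as entourages are symmetric.
\<close>

lemma neutral_iff_chain_lifting:
  "neutral_action G X U \<phi> \<longleftrightarrow> chain_lifting X U (orbits G X \<phi>) (orbit G \<phi>)"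
proof -
  let ?p = "orbit G \<phi>"
  have "(\<forall>x\<in>X. \<forall>y\<in>X. \<forall>h\<in>carrier G. (x, \<phi> h y) \<in> F \<longrightarrow> (\<exists>g\<in>carrier G. (\<phi> g x, y) \<in> E))
     \<longleftrightarrow> (\<forall>y\<in>X. \<forall>q. (?p y, q) \<in> map_prod ?p ?p ` F \<longrightarrow> (\<exists>z. (y, z) \<in> E \<and> ?p z = q))"
    (is "?neutral \<longleftrightarrow> ?edges") if E: "E \<in> U" and F: "F \<in> U" for E F
  proof
    assume neutral: ?neutral
    show ?edges
    proof (intro ballI allI impI)
      fix y q assume y: "y \<in> X" and "(?p y, q) \<in> map_prod ?p ?p ` F"
      then obtain a x where ax: "(a, x) \<in> F" "?p y = ?p a" "q = ?p x"
        by auto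
      have X: "a \<in> X" "x \<in> X" using ax entourage_in_carrier[OF F] by auto
      obtain h where "h \<in> carrier G" "a = \<phi> h y"
        using ax y X orbit_eq_iff by auto
      moreover have "(x, a) \<in> F"
        using ax entourage_sym[OF F] by (blast dest: symD)
      ultimately obtain g where g: "g \<in> carrier G" "(\<phi> g x, y) \<in> E"
        using neutral X y by blast
      have "(y, \<phi> g x) \<in> E"
        using g entourage_sym[OF E] by (blast dest: symD)
      moreover have "?p (\<phi> g x) = q"
        using ax X g orbit_eq_iff[of x "\<phi> g x"] element_image by auto
      ultimately show "\<exists>z. (y, z) \<in> E \<and> ?p z = q" by blast
    qed
  next
    assume edges: ?edges
    show ?neutral
    proof (intro ballI impI)
      fix x y h assume *: "x \<in> X" "y \<in> X" "h \<in> carrier G" "(x, \<phi> h y) \<in> F"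
      then have "(\<phi> h y, x) \<in> F"
        using entourage_sym[OF F] by (blast dest: symD)
      moreover have "?p y = ?p (\<phi> h y)"
        using * orbit_eq_iff[of y "\<phi> h y"] element_image by auto
      ultimately have "(?p y, ?p x) \<in> map_prod ?p ?p ` F"
        by force
      then obtain z where z: "(y, z) \<in> E" "?p z = ?p x"
        using edges * by metis
      then obtain g where "g \<in> carrier G" "z = \<phi> g x"
        using * orbit_eq_iff[of x z] entourage_in_carrier[OF E] by auto
      then show "\<exists>g\<in>carrier G. (\<phi> g x, y) \<in> E"
        using z entourage_sym[OF E] by (blast dest: symD)
    qed
  qed
  moreover have "?p ` X = orbits G X \<phi>"
    by (auto simp: orbits_def)
  ultimately show ?thesis
    unfolding neutral_action_def chain_lifting_iff_edge_lifting by simp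
qed

lemma neutral_iff_uniform_covering_map:
  assumes "unique_chain_lifts X U (orbit G \<phi>)"
  shows "neutral_action G X U \<phi> \<longleftrightarrow>
    uniform_covering_map X U (orbits G X \<phi>)
      (generated_structure U (orbits G X \<phi>) (orbit G \<phi>)) (orbit G \<phi>)"
  using assms chain_lifting_imp_generated_structure uniform_structure_axioms
  by (auto simp: neutral_iff_chain_lifting uniform_covering_map_def orbits_def)

lemma uniformly_properly_discontinuous_imp_unique_chain_lifts:
  assumes "uniformly_properly_discontinuous G X U \<phi>"
  shows "unique_chain_lifts X U (orbit G \<phi>)"
proof -
  obtain E where E: "E \<in> U"
    and free: "\<And>x g. x \<in> X \<Longrightarrow> g \<in> carrier G \<Longrightarrow> (x, \<phi> g x) \<in> E \<Longrightarrow> g = \<one>\<^bsub>G\<^esub>"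
    using assms unfolding uniformly_properly_discontinuous_def by blast
  have "a = b" if ab: "(a, b) \<in> E" "orbit G \<phi> a = orbit G \<phi> b" for a b
  proof -
    have X: "a \<in> X" "b \<in> X" using ab entourage_in_carrier[OF E] by auto
    then obtain g where g: "g \<in> carrier G" "b = \<phi> g a"
      using ab orbit_eq_iff by blast
    then have "g = \<one>\<^bsub>G\<^esub>" using free ab X by blast
    then show ?thesis using g X id_eq_one by (metis restrict_apply')
  qed
  then show ?thesis
    using locally_injective_imp_unique_chain_lifts[OF E] by blast
qed

text \<open>For a small entourage \<open>F\<close> the group \<open>G\<^sub>F\<close> is trivial.\<close>

lemma uniformly_properly_discontinuous_imp_small_scale_uniformly_continuous:
  assumes "uniformly_properly_discontinuous G X U \<phi>"
  shows "small_scale_uniformly_continuous G X U \<phi>"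
proof -
  interpret group G
    using group_hom group_hom.axioms(1) by auto
  obtain F where F: "F \<in> U" and "small_displacement G X \<phi> F \<subseteq> {\<one>\<^bsub>G\<^esub>}"
    using assms unfolding uniformly_properly_discontinuous_def small_displacement_def by blast
  then have "generate G (small_displacement G X \<phi> F) = {\<one>\<^bsub>G\<^esub>}"
    using generate_one generate_empty by (metis subset_singletonD)
  moreover have "preimage_rel X (\<phi> \<one>\<^bsub>G\<^esub>) E = E" if "E \<in> U" for E
    using entourage_in_carrier[OF that] by (auto simp: preimage_rel_def simp flip: id_eq_one)
  ultimately show ?thesis
    using F unfolding small_scale_uniformly_continuous_def by (auto intro!: bexI[of _ F])
qed

text \<open>
  The entourage found here lies inside one on which lifts are unique, so that \<open>(x, g \<cdot> x)\<close> may
  serve as the first edge of a chain, and inside one whose group has small scale uniform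
  continuity, so that \<open>g\<close> carries sufficiently fine chains to chains to which uniqueness
  applies.
\<close>

lemma unique_lifts_imp_uniformly_properly_discontinuous:
  assumes cont: "small_scale_uniformly_continuous G X U \<phi>"
    and unique: "unique_chain_lifts X U (orbit G \<phi>)"
    and conn: "chain_connected X U"
    and faithful: "faithful_action G X \<phi>"
  shows "uniformly_properly_discontinuous G X U \<phi>"
proof -
  obtain F where F: "F \<in> U" and uniq: "\<And>\<alpha> \<beta>. chain_in X F \<alpha> \<Longrightarrow> chain_in X F \<beta> \<Longrightarrow>
      map (orbit G \<phi>) \<alpha> = map (orbit G \<phi>) \<beta> \<Longrightarrow> hd \<alpha> = hd \<beta> \<Longrightarrow> \<alpha> = \<beta>"
    using unique entourage_ex unfolding unique_chain_lifts_def by blast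
  obtain F' where F': "F' \<in> U"
    and pre: "\<And>g. g \<in> generate G (small_displacement G X \<phi> F') \<Longrightarrow> preimage_rel X (\<phi> g) F \<in> U"
    using cont F unfolding small_scale_uniformly_continuous_def by blast
  have "g = \<one>\<^bsub>G\<^esub>" if x: "x \<in> X" and g: "g \<in> carrier G" and xg: "(x, \<phi> g x) \<in> F \<inter> F'" for x g
  proof -
    have "g \<in> generate G (small_displacement G X \<phi> F')"
      using x g xg by (auto simp: small_displacement_def intro!: generate.incl)
    then have fine: "F \<inter> preimage_rel X (\<phi> g) F \<in> U"
      using pre F entourage_Int by blast
    have "\<phi> g y = y" if y: "y \<in> X" for y
    proof -
      obtain \<alpha> where \<alpha>: "chain_in X (F \<inter> preimage_rel X (\<phi> g) F) \<alpha>" "hd \<alpha> = x" "last \<alpha> = y"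
        using conn fine x y unfolding chain_connected_def by blast
      have ne: "\<alpha> \<noteq> []" and sub: "set \<alpha> \<subseteq> X"
        using \<alpha> by (auto simp: chain_in_def)
      have succ: "successively (\<lambda>a b. (a, b) \<in> F) \<alpha>"
        "successively (\<lambda>a b. (\<phi> g a, \<phi> g b) \<in> F) \<alpha>"
        using \<alpha>(1) by (auto simp: chain_in_def preimage_rel_def elim: successively_mono)
      (* The repeated point x gives this chain the length of the other one, whose
         first edge is (x, g x). *)
      have "chain_in X F (x # \<alpha>)"
        using x ne sub succ \<alpha>(2) entourage_refl[OF F]
        by (simp add: chain_in_def successively_Cons)
      moreover have "chain_in X F (x # map (\<phi> g) \<alpha>)"
        using x g xg ne sub succ \<alpha>(2) element_image
        by (auto simp: chain_in_def successively_Cons successively_map hd_map)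
      moreover have "orbit G \<phi> a = orbit G \<phi> (\<phi> g a)" if "a \<in> X" for a
        using that g orbit_eq_iff element_image by blast
      then have "map (orbit G \<phi>) \<alpha> = map (orbit G \<phi>) (map (\<phi> g) \<alpha>)"
        using sub by auto
      ultimately have "\<alpha> = map (\<phi> g) \<alpha>"
        using uniq[of "x # \<alpha>" "x # map (\<phi> g) \<alpha>"] by simp
      then show ?thesis
        using \<alpha>(3) ne by (metis last_map)
    qed
    then show ?thesis
      using faithful g unfolding faithful_action_iff by blast
  qed
  then show ?thesis
    using entourage_Int[OF F F'] unfolding uniformly_properly_discontinuous_def by blast
qed

end

section \<open>Characterisation of the actions whose orbit map is a covering\<close>

theorem corollary3p9:
  fixes G :: "('g, 'm) monoid_scheme"
    and X :: "'a set"
    and U :: "('a \<times> 'a) set set"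
    and \<phi> :: "'g \<Rightarrow> 'a \<Rightarrow> 'a"
  assumes "uniform_structure X U"
    and "chain_connected X U"
    and "faithful_action G X \<phi>"
  shows "(small_scale_uniformly_continuous G X U \<phi> \<and>
          uniform_covering_map X U (orbits G X \<phi>)
            (generated_structure U (orbits G X \<phi>) (orbit G \<phi>)) (orbit G \<phi>))
     \<longleftrightarrow> (neutral_action G X U \<phi> \<and> uniformly_properly_discontinuous G X U \<phi>)"
proof -
  interpret uniform_action X U G \<phi>
    using assms by (simp add: uniform_action_def faithful_action_def)
  show ?thesis
  proof
    assume *: "small_scale_uniformly_continuous G X U \<phi> \<and>
      uniform_covering_map X U (orbits G X \<phi>)
        (generated_structure U (orbits G X \<phi>) (orbit G \<phi>)) (orbit G \<phi>)"
    then have "unique_chain_lifts X U (orbit G \<phi>)"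
      by (simp add: uniform_covering_map_def)
    with * show "neutral_action G X U \<phi> \<and> uniformly_properly_discontinuous G X U \<phi>"
      using neutral_iff_uniform_covering_map
        unique_lifts_imp_uniformly_properly_discontinuous assms(2,3) by blast
  next
    assume "neutral_action G X U \<phi> \<and> uniformly_properly_discontinuous G X U \<phi>"
    then show "small_scale_uniformly_continuous G X U \<phi> \<and>
      uniform_covering_map X U (orbits G X \<phi>)
        (generated_structure U (orbits G X \<phi>) (orbit G \<phi>)) (orbit G \<phi>)"
      using neutral_iff_uniform_covering_map
        uniformly_properly_discontinuous_imp_unique_chain_lifts
        uniformly_properly_discontinuous_imp_small_scale_uniformly_continuous by blast
  qed
qed

end
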